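(* For all integers $n\ge1$ and $k\ge1$, the number of 1-ball prime passing patterns of period $n$ with $k$ hands is $$P'(1,n,k)=\sum_{h=1}^k\binom kh\binom{n-1}{h-1}(h-1)!.$$
   Context: A $b$-ball passing state with $k$ hands is a $k\times\infty$ matrix $A=(a_{i,j})_{1\le i\le k,\,j\ge1}$ with entries in $\{0,1\}$, finitely many nonzero, whose entries sum to $b$; $a_{i,j}=1$ means a ball is scheduled to land at hand $i$ in $j$ beats. There is a transition $A\to B$ iff $a_{i,j+1}\le b_{i,j}$ for all $i$ and all $j\ge1$. A prime passing pattern of period $n$ is a directed cycle of length $n$ in this graph (a closed walk of length $n$ visiting $n$ distinct states), counted up to cyclic rotation. $P'(b,n,k)$ denotes the number of such patterns. *)

theory Defs
  imports Complex_Main "Graph_Theory.Arc_Walk"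
begin

(* A k x infinity matrix with rows 1..k and columns 1, 2, ... is a function of the
   row and the column index (both counted from 1) that vanishes outside this index
   range, so that distinct functions are distinct matrices. *)
type_synonym state = "nat \<Rightarrow> nat \<Rightarrow> nat"

definition passing_states :: "nat \<Rightarrow> nat \<Rightarrow> state set" where
  "passing_states b k = {A.
     (\<forall>i\<in>{1..k}. \<forall>j\<ge>1. A i j \<in> {0, 1}) \<and>
     (\<forall>i j. \<not> (i \<in> {1..k} \<and> j \<ge> 1) \<longrightarrow> A i j = 0) \<and>
     finite {(i, j). A i j \<noteq> 0} \<and>
     (\<Sum>(i, j)\<in>{(i, j). A i j \<noteq> 0}. A i j) = b}"

definition transition :: "nat \<Rightarrow> state \<Rightarrow> state \<Rightarrow> bool" where
  "transition k A B \<longleftrightarrow> (\<forall>i\<in>{1..k}. \<forall>j\<ge>1. A i (j + 1) \<le> B i j)"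

definition passing_graph :: "nat \<Rightarrow> nat \<Rightarrow> (state, state \<times> state) pre_digraph" where
  "passing_graph b k =
     \<lparr>verts = passing_states b k,
      arcs = {(A, B). A \<in> passing_states b k \<and> B \<in> passing_states b k \<and> transition k A B},
      tail = fst,
      head = snd\<rparr>"

(* A cycle in the sense of the graph library is a nonempty closed walk, given as the
   list of its arcs, that visits no vertex twice; loops are cycles of length 1. *)
definition prime_cycles :: "nat \<Rightarrow> nat \<Rightarrow> nat \<Rightarrow> (state \<times> state) list set" where
  "prime_cycles b n k = {p. pre_digraph.cycle (passing_graph b k) p \<and> length p = n}"

definition rotation_rel :: "'a list set \<Rightarrow> ('a list \<times> 'a list) set" where
  "rotation_rel C = {(p, q). p \<in> C \<and> q \<in> C \<and> (\<exists>m. q = rotate m p)}"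

lemma equiv_rotation_rel: "equiv C (rotation_rel C)"
proof (rule equivI)
  show "rotation_rel C \<subseteq> C \<times> C"
    by (auto simp: rotation_rel_def)
  show "refl_on C (rotation_rel C)"
    by (auto simp: rotation_rel_def refl_on_def intro!: exI[of _ 0])
  show "sym (rotation_rel C)"
  proof (rule symI)
    fix p q assume "(p, q) \<in> rotation_rel C"
    then obtain m where *: "p \<in> C" "q \<in> C" "q = rotate m p"
      by (auto simp: rotation_rel_def)
    have "p = rotate (length p - m mod length p) q"
    proof (cases "p = []")
      case False
      have "rotate (length p - m mod length p) q
          = rotate (length p - m mod length p + m mod length p) p"
        using *(3) by (simp only: rotate_conv_mod[of m p] rotate_rotate)
      then show ?thesis using False by (simp add: less_imp_le)
    qed (use * in simp)
    then show "(q, p) \<in> rotation_rel C"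
      using * by (auto simp: rotation_rel_def)
  qed
  show "trans (rotation_rel C)"
    by (rule transI) (auto simp: rotation_rel_def rotate_rotate)
qed

(* P'(b, n, k). *)
definition num_prime_patterns :: "nat \<Rightarrow> nat \<Rightarrow> nat \<Rightarrow> nat" where
  "num_prime_patterns b n k = card (prime_cycles b n k // rotation_rel (prime_cycles b n k))"

end

theory Submission
  imports Defs "HOL-Combinatorics.Multiset_Permutations"
begin

text \<open>
  A state with one ball is the position of its nonzero entry. A position (i, j) with j > 1 must be
  followed by (i, j - 1), whereas (i, 1) may be followed by any position. Hence a prime pattern
  breaks into runs (i, m), (i, m - 1), ..., (i, 1), and since its states are distinct, the hands i
  of its h runs are distinct. Rotate the pattern so that the run of the smallest hand comes last:
  the pattern is then determined by the set of hands, an arrangement of the other h - 1 hands, and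
  a composition of n into the h run lengths.
\<close>

section \<open>Cycles as cyclic words of ball positions\<close>

definition unit_state :: "nat \<times> nat \<Rightarrow> state" where
  "unit_state p = (\<lambda>i j. if (i, j) = p then 1 else 0)"

definition positions :: "nat \<Rightarrow> (nat \<times> nat) set" where
  "positions k = {1..k} \<times> {1..}"

definition step :: "nat \<times> nat \<Rightarrow> nat \<times> nat \<Rightarrow> bool" where
  "step p q \<longleftrightarrow> snd p = 1 \<or> q = (fst p, snd p - 1)"

lemma step_catch [simp]: "step (i, Suc 0) q"
  by (simp add: step_def)

lemma inj_unit_state: "inj unit_state"
proof (rule injI)
  fix p q assume "unit_state p = unit_state q"
  then have "unit_state q (fst p) (snd p) = 1"
    by (metis prod.collapse unit_state_def)
  then show "p = q"
    by (auto simp: unit_state_def split: if_splits)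
qed

text \<open>A finite sum of naturals is 1 only if one summand is 1 and all others vanish, so exactly
  one entry is nonzero.\<close>

lemma passing_states_1: "passing_states 1 k = unit_state ` positions k"
proof (intro equalityI subsetI)
  fix A assume A: "A \<in> passing_states 1 k"
  let ?S = "{(i, j). A i j \<noteq> 0}"
  have fin: "finite ?S" and sum: "(\<Sum>(i, j)\<in>?S. A i j) = 1"
    and zero: "\<And>i j. \<not> (i \<in> {1..k} \<and> j \<ge> 1) \<Longrightarrow> A i j = 0"
    using A by (auto simp: passing_states_def)
  obtain p where p: "p \<in> ?S" "(case p of (i, j) \<Rightarrow> A i j) = 1"
    and only: "\<forall>q\<in>?S. p \<noteq> q \<longrightarrow> (case q of (i, j) \<Rightarrow> A i j) = 0"
    using sum[unfolded sum_eq_1_iff[OF fin]] by (elim bexE conjE) rule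
  have "A i j = unit_state p i j" for i j
  proof (cases "(i, j) = p")
    case True
    with p(2) show ?thesis by (auto simp: unit_state_def)
  next
    case False
    with only have "A i j = 0" by (auto dest: bspec[of _ _ "(i, j)"])
    with False show ?thesis by (simp add: unit_state_def)
  qed
  then have "A = unit_state p" by (intro ext)
  moreover have "p \<in> positions k"
    using p(2) zero[of "fst p" "snd p"] by (cases p) (auto simp: positions_def)
  ultimately show "A \<in> unit_state ` positions k" by blast
next
  fix A assume "A \<in> unit_state ` positions k"
  then obtain p where p: "p \<in> positions k" "A = unit_state p" by blast
  then have "{(i, j). A i j \<noteq> 0} = {p}"
    by (auto simp: unit_state_def)
  then show "A \<in> passing_states 1 k"
    using p by (auto simp: passing_states_def unit_state_def positions_def)
qed

text \<open>Only the entry of \<open>A\<close> at \<open>p\<close> can violate the inequality. In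
  column 1 it is never compared; in a later column it forces the ball of \<open>q\<close> into the
  same row, one column earlier.\<close>

lemma transition_unit_state:
  assumes "p \<in> positions k" and "q \<in> positions k"
  shows "transition k (unit_state p) (unit_state q) \<longleftrightarrow> step p q"
proof
  assume t: "transition k (unit_state p) (unit_state q)"
  show "step p q"
  proof (cases "snd p = 1")
    case False
    then have "fst p \<in> {1..k}" "snd p - 1 \<ge> 1" "snd p - 1 + 1 = snd p"
      using assms by (auto simp: positions_def)
    with t have "unit_state p (fst p) (snd p) \<le> unit_state q (fst p) (snd p - 1)"
      unfolding transition_def by metis
    then show ?thesis
      by (auto simp: unit_state_def step_def split: if_splits)
  qed (simp add: step_def)
next
  assume "step p q"
  then show "transition k (unit_state p) (unit_state q)"
    by (cases p) (auto simp: transition_def unit_state_def step_def)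
qed

section \<open>Closed walks as cyclic words\<close>

text \<open>Zipping with the rotated word supplies the closing arc from the last vertex to the
  first; a one-letter word yields a loop.\<close>

definition arc_list :: "'a list \<Rightarrow> ('a \<times> 'a) list" where
  "arc_list w = zip w (rotate1 w)"

lemma length_arc_list [simp]: "length (arc_list w) = length w"
  by (simp add: arc_list_def)

lemma arc_list_Nil_iff [simp]: "arc_list w = [] \<longleftrightarrow> w = []"
  by (metis length_0_conv length_arc_list)

lemma map_fst_arc_list [simp]: "map fst (arc_list w) = w"
  by (simp add: arc_list_def)

lemma arc_list_eq_iff [simp]: "arc_list v = arc_list w \<longleftrightarrow> v = w"
  by (metis map_fst_arc_list)

lemma arc_list_map: "arc_list (map f w) = map (map_prod f f) (arc_list w)"
  by (simp add: arc_list_def rotate1_map zip_map_map map_prod_def)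

lemma rotate1_zip:
  "length xs = length ys \<Longrightarrow> rotate1 (zip xs ys) = zip (rotate1 xs) (rotate1 ys)"
  by (cases xs; cases ys) auto

lemma arc_list_rotate1: "arc_list (rotate1 w) = rotate1 (arc_list w)"
  by (simp add: arc_list_def rotate1_zip)

lemma arc_list_rotate: "arc_list (rotate m w) = rotate m (arc_list w)"
  by (induction m) (simp_all add: arc_list_rotate1)

lemma set_arc_list_subset: "set (arc_list w) \<subseteq> set w \<times> set w"
  unfolding arc_list_def by (auto dest: set_zip_leftD set_zip_rightD)

lemma arc_list_successor:
  assumes "p \<in> set w"
  obtains q where "q \<in> set w" "(p, q) \<in> set (arc_list w)"
proof -
  from assms have "p \<in> fst ` set (arc_list w)"
    by (metis map_fst_arc_list list.set_map)
  then obtain q where "(p, q) \<in> set (arc_list w)" by force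
  with set_arc_list_subset[of w] that show thesis by blast
qed

text \<open>The closing vertex is a free \<open>x\<close> because \<open>hd w\<close> would change
  along the induction; \<open>x = hd w\<close> gives the arc list.\<close>

lemma ball_set_zip_shift:
  "(\<forall>(p, q)\<in>set (zip w (tl w @ [x])). P p q) \<longleftrightarrow> successively P (w @ [x])"
proof (induction w)
  case (Cons a w)
  then show ?case by (cases w) auto
qed simp

text \<open>Separates the wrap-around arc from the linear condition, so that it can be discharged
  once the word ends at a catch.\<close>

lemma ball_arc_list_iff:
  assumes "w \<noteq> []"
  shows "(\<forall>(p, q)\<in>set (arc_list w). P p q) \<longleftrightarrow> successively P w \<and> P (last w) (hd w)"
proof -
  have "arc_list w = zip w (tl w @ [hd w])"
    using assms by (cases w) (simp_all add: arc_list_def)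
  then show ?thesis
    using assms ball_set_zip_shift[of w "hd w" P]
    by (simp add: successively_append_iff)
qed

definition cyclic_words :: "nat \<Rightarrow> nat \<Rightarrow> (nat \<times> nat) list set" where
  "cyclic_words n k = {w. w \<noteq> [] \<and> length w = n \<and> distinct w \<and> set w \<subseteq> positions k \<and>
     (\<forall>(p, q)\<in>set (arc_list w). step p q)}"

lemma rotate_in_cyclic_words [simp]: "rotate m w \<in> cyclic_words n k \<longleftrightarrow> w \<in> cyclic_words n k"
  by (simp add: cyclic_words_def arc_list_rotate)

section \<open>Cycles of the passing graph\<close>

lemma cas_passing_graph_iff:
  "pre_digraph.cas (passing_graph b k) u p v \<longleftrightarrow> u # map snd p = map fst p @ [v]"
  by (induction p arbitrary: u)
    (auto simp: pre_digraph.cas.simps passing_graph_def)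

lemma tl_awalk_verts_passing_graph:
  "pre_digraph.cas (passing_graph b k) u p v \<Longrightarrow>
     tl (pre_digraph.awalk_verts (passing_graph b k) u p) = map snd p"
proof (induction p arbitrary: u)
  case (Cons e p)
  then show ?case
    by (cases p) (auto simp: pre_digraph.cas.simps pre_digraph.awalk_verts.simps passing_graph_def)
qed (simp add: pre_digraph.awalk_verts.simps)

text \<open>The list equation says that the heads are the tails rotated by one place, so
  \<open>w = map fst p\<close> works.\<close>

lemma closed_cas_iff_arc_list:
  "p \<noteq> [] \<Longrightarrow> (\<exists>u. u # map snd p = map fst p @ [u]) \<longleftrightarrow> (\<exists>w. p = arc_list w)"
proof
  assume p: "p \<noteq> []" and "\<exists>u. u # map snd p = map fst p @ [u]"
  then have "map snd p = rotate1 (map fst p)"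
    by (cases p) auto
  then have "p = arc_list (map fst p)"
    unfolding arc_list_def by (metis zip_map_fst_snd)
  then show "\<exists>w. p = arc_list w" ..
next
  assume p: "p \<noteq> []" and "\<exists>w. p = arc_list w"
  then obtain w where w: "p = arc_list w" by blast
  with p have "hd w # map snd p = map fst p @ [hd w]"
    by (cases w) (auto simp: arc_list_def)
  then show "\<exists>u. u # map snd p = map fst p @ [u]" ..
qed

text \<open>The library asks for distinctness of the visited vertices without the first one. These
  are the heads of the arcs, that is \<open>rotate1 w\<close>, so the condition amounts to
  \<open>distinct w\<close>.\<close>

lemma cycle_passing_graph_iff:
  "pre_digraph.cycle (passing_graph b k) p \<longleftrightarrow>
     p \<noteq> [] \<and> (\<exists>w. p = arc_list w \<and> distinct w) \<and> set p \<subseteq> arcs (passing_graph b k)"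
  (is "?L \<longleftrightarrow> ?R")
proof
  let ?G = "passing_graph b k"
  assume ?L
  then obtain u where p: "p \<noteq> []" "set p \<subseteq> arcs ?G" "pre_digraph.cas ?G u p u"
    "distinct (tl (pre_digraph.awalk_verts ?G u p))"
    by (auto simp: pre_digraph.cycle_def pre_digraph.awalk_def)
  then obtain w where w: "p = arc_list w"
    using closed_cas_iff_arc_list[of p] by (auto simp: cas_passing_graph_iff)
  have "distinct (map snd p)"
    using p tl_awalk_verts_passing_graph by metis
  then have "distinct w"
    by (simp add: w arc_list_def)
  with p w show ?R by blast
next
  let ?G = "passing_graph b k"
  assume R: ?R
  then obtain w where w: "p = arc_list w" "distinct w" by blast
  with R obtain u where u: "u # map snd p = map fst p @ [u]"
    using closed_cas_iff_arc_list by blast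
  then have cas: "pre_digraph.cas ?G u p u"
    by (simp add: cas_passing_graph_iff)
  have "fst (hd p) \<in> verts ?G"
    using R by (cases p) (auto simp: passing_graph_def)
  moreover have "fst (hd p) = u"
    using R u by (cases p) auto
  moreover have "distinct (map snd p)"
    using w by (simp add: arc_list_def)
  ultimately show ?L
    using R cas tl_awalk_verts_passing_graph[OF cas]
    by (auto simp: pre_digraph.cycle_def pre_digraph.awalk_def)
qed

text \<open>The vertex word of a cycle lifts letter by letter along \<open>unit_state\<close>, and
  its arcs turn into instances of \<open>step\<close>. Conversely, injectivity of
  \<open>unit_state\<close> keeps the image of a word distinct.\<close>

lemma prime_cycles_1:
  "prime_cycles 1 n k = (\<lambda>w. arc_list (map unit_state w)) ` cyclic_words n k"
proof (intro equalityI subsetI)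
  fix p assume "p \<in> prime_cycles 1 n k"
  then obtain v where v: "p \<noteq> []" "p = arc_list v" "distinct v" "length p = n"
    and arcs: "set p \<subseteq> arcs (passing_graph 1 k)"
    by (auto simp: prime_cycles_def cycle_passing_graph_iff)
  have "set v = fst ` set p"
    unfolding v(2) by (metis map_fst_arc_list list.set_map)
  with arcs have "set v \<subseteq> unit_state ` positions k"
    by (auto simp: passing_graph_def passing_states_1 simp del: One_nat_def)
  then have "v \<in> map unit_state ` lists (positions k)"
    by (auto simp flip: lists_image)
  then obtain w where w: "v = map unit_state w" "set w \<subseteq> positions k"
    by auto
  have "step a b" if "(a, b) \<in> set (arc_list w)" for a b
  proof -
    have "(unit_state a, unit_state b) \<in> set p"
      using that by (force simp: v w arc_list_map)
    with arcs have "transition k (unit_state a) (unit_state b)"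
      by (auto simp: passing_graph_def)
    moreover have "a \<in> positions k" "b \<in> positions k"
      using that set_arc_list_subset w by blast+
    ultimately show ?thesis
      by (simp add: transition_unit_state)
  qed
  then have "w \<in> cyclic_words n k"
    using v w by (auto simp: cyclic_words_def distinct_map)
  with v w show "p \<in> (\<lambda>w. arc_list (map unit_state w)) ` cyclic_words n k"
    by blast
next
  fix p assume "p \<in> (\<lambda>w. arc_list (map unit_state w)) ` cyclic_words n k"
  then obtain w where w: "w \<in> cyclic_words n k" "p = arc_list (map unit_state w)" by blast
  have "(x, y) \<in> arcs (passing_graph 1 k)" if "(x, y) \<in> set p" for x y
  proof -
    from that obtain a b where ab: "(a, b) \<in> set (arc_list w)" "x = unit_state a" "y = unit_state b"
      by (auto simp: w arc_list_map)
    moreover have "a \<in> positions k" "b \<in> positions k"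
      using ab(1) set_arc_list_subset[of w] w by (auto simp: cyclic_words_def)
    ultimately show ?thesis
      using w by (auto simp: passing_graph_def passing_states_1 transition_unit_state cyclic_words_def
          simp del: One_nat_def)
  qed
  moreover have "distinct (map unit_state w)"
    using w inj_unit_state by (auto simp: cyclic_words_def distinct_map intro: inj_on_subset)
  ultimately show "p \<in> prime_cycles 1 n k"
    using w by (auto simp: prime_cycles_def cycle_passing_graph_iff cyclic_words_def)
qed

section \<open>Standard representatives of the rotation classes\<close>

text \<open>Ending a word at a catch makes the cyclic condition linear: \<^const>\<open>step\<close> imposes nothing
  after a position (i, 1).\<close>

definition standard_words :: "nat \<Rightarrow> nat \<Rightarrow> (nat \<times> nat) list set" where
  "standard_words n k = {w \<in> cyclic_words n k.
     snd (last w) = 1 \<and> (\<forall>i. (i, 1) \<in> set w \<longrightarrow> fst (last w) \<le> i)}"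

text \<open>The map from \<open>t\<close> to its class is a bijection from \<open>T\<close> onto the
  quotient: \<open>ex\<close> gives surjectivity, \<open>uniq\<close> injectivity.\<close>

lemma card_quotient_transversal:
  assumes "equiv C R" and "T \<subseteq> C"
    and ex: "\<And>c. c \<in> C \<Longrightarrow> \<exists>t\<in>T. (c, t) \<in> R"
    and uniq: "\<And>s t. s \<in> T \<Longrightarrow> t \<in> T \<Longrightarrow> (s, t) \<in> R \<Longrightarrow> s = t"
  shows "card (C // R) = card T"
proof -
  have "inj_on (\<lambda>t. R `` {t}) T"
    using assms by (intro inj_onI) (meson eq_equiv_class subsetD)
  moreover have "C // R = (\<lambda>t. R `` {t}) ` T"
  proof (intro equalityI subsetI)
    fix X assume "X \<in> C // R"
    then obtain c where c: "c \<in> C" "X = R `` {c}" by (auto elim: quotientE)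
    with ex obtain t where "t \<in> T" "(c, t) \<in> R" by blast
    with c show "X \<in> (\<lambda>t. R `` {t}) ` T"
      using equiv_class_eq[OF assms(1)] by blast
  next
    fix X assume "X \<in> (\<lambda>t. R `` {t}) ` T"
    then show "X \<in> C // R"
      using assms(2) by (auto intro: quotientI)
  qed
  ultimately show ?thesis by (simp add: card_image)
qed

text \<open>Take a position of \<open>w\<close> with the least second component. If that exceeded 1,
  its cyclic successor would have a smaller one.\<close>

lemma cyclic_word_has_catch:
  assumes "w \<in> cyclic_words n k"
  shows "\<exists>i. (i, 1) \<in> set w"
proof -
  have "w \<noteq> []" using assms by (simp add: cyclic_words_def)
  then obtain p where p: "p \<in> set w" "\<And>q. q \<in> set w \<Longrightarrow> snd p \<le> snd q"
    using arg_min_if_finite[of "set w" snd] by (metis List.finite_set not_le set_empty)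
  obtain q where q: "q \<in> set w" "(p, q) \<in> set (arc_list w)"
    using arc_list_successor[OF p(1)] .
  then have "step p q" and "snd p \<ge> 1"
    using assms p(1) by (auto simp: cyclic_words_def positions_def)
  with p(2)[OF q(1)] have "snd p = 1"
    by (auto simp: step_def)
  with p(1) show ?thesis by (metis prod.collapse)
qed

text \<open>Cut \<open>w\<close> just after the catch of the smallest hand and swap the two
  pieces.\<close>

lemma ex_standard_rotation:
  assumes "w \<in> cyclic_words n k"
  shows "\<exists>m. rotate m w \<in> standard_words n k"
proof -
  define i where "i = (LEAST i. (i, 1::nat) \<in> set w)"
  have "(i, 1) \<in> set w" and le: "\<And>j. (j, 1) \<in> set w \<Longrightarrow> i \<le> j"
    unfolding i_def using cyclic_word_has_catch[OF assms] by (auto intro: LeastI Least_le)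
  then obtain a b where w: "w = (a @ [(i, 1)]) @ b"
    by (auto dest: split_list)
  have "rotate (length (a @ [(i, 1)])) w = b @ a @ [(i, 1)]"
    unfolding w by (rule rotate_append)
  then have last: "last (rotate (length (a @ [(i, 1)])) w) = (i, 1)"
    by simp
  show ?thesis
    by (intro exI[of _ "length (a @ [(i, 1)])"])
      (use assms le in \<open>simp add: standard_words_def last del: length_append One_nat_def\<close>)
qed

text \<open>Both words end at the catch of the smallest hand, hence in the same letter. A nontrivial
  rotation would place that letter in both pieces of \<open>v\<close>, against distinctness.\<close>

lemma standard_rotation_unique:
  assumes v: "v \<in> standard_words n k" and w: "rotate m v \<in> standard_words n k"
  shows "rotate m v = v"
proof (rule ccontr)
  assume neq: "rotate m v \<noteq> v"
  let ?m = "m mod length v"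
  have v': "v \<noteq> []" "distinct v"
    using v by (auto simp: standard_words_def cyclic_words_def)
  have m: "0 < ?m" "?m < length v"
    using neq v' by (metis gr0I rotate_conv_mod rotate0 id_apply) (use v' in simp)
  have rot: "rotate m v = drop ?m v @ take ?m v"
    by (rule rotate_drop_take)
  have "last (rotate m v) = last v"
  proof (rule prod_eqI)
    have "(fst p, 1) \<in> set v" if "p \<in> set v" "snd p = 1" for p
      using that by (metis prod.collapse)
    moreover have "last v \<in> set v" "last (rotate m v) \<in> set v"
      using v' last_in_set[of v] last_in_set[of "rotate m v"] by auto
    ultimately have "(fst (last v), 1) \<in> set v" "(fst (last (rotate m v)), 1) \<in> set v"
      using v w by (auto simp: standard_words_def)
    then show "fst (last (rotate m v)) = fst (last v)"
      using v w by (auto simp: standard_words_def intro: antisym)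
    show "snd (last (rotate m v)) = snd (last v)"
      using v w by (simp add: standard_words_def)
  qed
  moreover have "last (rotate m v) \<in> set (take ?m v)"
    using m unfolding rot by (subst last_append) (auto intro!: last_in_set)
  moreover have "last v \<in> set (drop ?m v)"
    using m by (metis drop_eq_Nil last_drop last_in_set not_le)
  ultimately show False
    using v'(2) by (metis append_take_drop_id disjoint_iff distinct_append)
qed

text \<open>Passing from words to arc lists is injective and commutes with rotation, so standard
  words give a transversal of the rotation classes.\<close>

lemma num_prime_patterns_1: "num_prime_patterns 1 n k = card (standard_words n k)"
proof -
  let ?C = "prime_cycles 1 n k" and ?arc = "\<lambda>w. arc_list (map unit_state w)"
  have inj: "inj ?arc"
    using inj_unit_state by (auto simp: inj_def)
  have rot: "?arc (rotate m w) = rotate m (?arc w)" for m w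
    by (simp add: arc_list_rotate flip: rotate_map)
  have "card (?C // rotation_rel ?C) = card (?arc ` standard_words n k)"
  proof (rule card_quotient_transversal[OF equiv_rotation_rel])
    show "?arc ` standard_words n k \<subseteq> ?C"
      by (auto simp: prime_cycles_1 standard_words_def simp del: One_nat_def)
  next
    fix c assume "c \<in> ?C"
    then obtain w where w: "w \<in> cyclic_words n k" "c = ?arc w"
      by (auto simp: prime_cycles_1 simp del: One_nat_def)
    then obtain m where m: "rotate m w \<in> standard_words n k"
      using ex_standard_rotation by blast
    have "?arc (rotate m w) \<in> ?C"
      using w by (simp add: prime_cycles_1 del: One_nat_def)
    with \<open>c \<in> ?C\<close> have "(c, ?arc (rotate m w)) \<in> rotation_rel ?C"
      unfolding rotation_rel_def w(2) rot by blast
    with m show "\<exists>t\<in>?arc ` standard_words n k. (c, t) \<in> rotation_rel ?C"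
      by blast
  next
    fix s t assume "s \<in> ?arc ` standard_words n k" "t \<in> ?arc ` standard_words n k"
      and "(s, t) \<in> rotation_rel ?C"
    then obtain v w m where "v \<in> standard_words n k" "w \<in> standard_words n k"
      "s = ?arc v" "t = ?arc w" "?arc w = ?arc (rotate m v)"
      by (auto simp: rotation_rel_def rot)
    moreover from this have "w = rotate m v"
      using injD[OF inj, of w "rotate m v"] by blast
    ultimately show "s = t"
      using standard_rotation_unique by metis
  qed
  also have "\<dots> = card (standard_words n k)"
    using inj by (intro card_image) (auto intro: inj_on_subset)
  finally show ?thesis by (simp add: num_prime_patterns_def)
qed

section \<open>Encoding standard words by throws\<close>

fun run :: "nat \<Rightarrow> nat \<Rightarrow> (nat \<times> nat) list" where
  "run i 0 = []"
| "run i (Suc m) = (i, Suc m) # run i m"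

text \<open>A pair \<open>(i, m)\<close> in the argument is a throw to hand \<open>i\<close> landing
  in \<open>m\<close> beats; it is replaced by the \<open>m\<close> positions it passes
  through.\<close>

fun expand :: "(nat \<times> nat) list \<Rightarrow> (nat \<times> nat) list" where
  "expand [] = []"
| "expand ((i, m) # xs) = run i m @ expand xs"

text \<open>A throw \<open>(i, 0)\<close> would expand to the empty word and could not be
  decoded.\<close>

abbreviation positive :: "(nat \<times> nat) list \<Rightarrow> bool" where
  "positive xs \<equiv> \<forall>x\<in>set xs. snd x \<ge> 1"

lemma length_run [simp]: "length (run i m) = m"
  by (induction m) auto

lemma set_run: "set (run i m) = {i} \<times> {1..m}"
  by (induction m) (auto simp: atLeastAtMostSuc_conv)

lemma distinct_run [simp]: "distinct (run i m)"
  by (induction m) (auto simp: set_run)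

lemma run_Nil_iff [simp]: "run i m = [] \<longleftrightarrow> m = 0"
  by (cases m) auto

lemma hd_run [simp]: "m \<ge> 1 \<Longrightarrow> hd (run i m) = (i, m)"
  by (cases m) auto

lemma last_run [simp]: "m \<ge> 1 \<Longrightarrow> last (run i m) = (i, 1)"
proof (induction m)
  case (Suc m)
  then show ?case by (cases m) auto
qed simp

lemma successively_run: "successively step (run i m)"
proof (induction m)
  case (Suc m)
  then show ?case by (cases m) (auto simp: step_def)
qed simp

lemma length_expand: "length (expand xs) = sum_list (map snd xs)"
  by (induction xs rule: expand.induct) auto

lemma set_expand: "set (expand xs) = (\<Union>(i, m)\<in>set xs. {i} \<times> {1..m})"
  by (induction xs rule: expand.induct) (auto simp: set_run)

lemma catch_in_expand_iff:
  "positive xs \<Longrightarrow> (i, 1) \<in> set (expand xs) \<longleftrightarrow> i \<in> fst ` set xs"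
  by (force simp: set_expand)

lemma expand_Nil_iff: "positive xs \<Longrightarrow> expand xs = [] \<longleftrightarrow> xs = []"
  by (cases xs) auto

lemma last_expand:
  "positive xs \<Longrightarrow> xs \<noteq> [] \<Longrightarrow> last (expand xs) = (fst (last xs), 1)"
  by (induction xs rule: expand.induct) (auto simp: last_append expand_Nil_iff)

text \<open>Each nonempty run ends at a catch, from which every step to the next run is
  allowed.\<close>

lemma successively_expand: "positive xs \<Longrightarrow> successively step (expand xs)"
  by (induction xs rule: expand.induct)
    (auto simp: successively_append_iff successively_run)

text \<open>Nonempty runs of the same hand share its catch, and runs of different hands are
  disjoint.\<close>

lemma distinct_expand_iff:
  "positive xs \<Longrightarrow> distinct (expand xs) \<longleftrightarrow> distinct (map fst xs)"
proof (induction xs rule: expand.induct)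
  case (2 i m xs)
  have "set (run i m) \<inter> set (expand xs) = {} \<longleftrightarrow> i \<notin> fst ` set xs"
    using 2(2) by (force simp: set_run set_expand)
  with 2 show ?case by auto
qed simp

text \<open>The first letter of the expansion is the first throw itself; cancel its run and
  recurse.\<close>

lemma inj_on_expand: "inj_on expand {xs. positive xs}"
proof (rule inj_onI, clarify)
  fix xs ys :: "(nat \<times> nat) list"
  assume "positive xs" "positive ys" "expand xs = expand ys"
  then show "xs = ys"
  proof (induction xs arbitrary: ys)
    case Nil
    then show ?case by (metis expand.simps(1) expand_Nil_iff)
  next
    case (Cons x xs)
    obtain i m where x: "x = (i, m)" by fastforce
    have "ys \<noteq> []"
      using Cons.prems by (metis expand.simps(1) expand_Nil_iff list.distinct(1))
    then obtain i' m' ys' where ys: "ys = (i', m') # ys'"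
      by (metis neq_Nil_conv surj_pair)
    have "m \<ge> 1" "m' \<ge> 1" using Cons.prems x ys by auto
    then have "(i, m) = hd (expand (x # xs))" "(i', m') = hd (expand ys)"
      by (simp_all add: x ys)
    then have "(i', m') = (i, m)" using Cons.prems(3) by simp
    with Cons x ys show ?case by simp
  qed
qed

text \<open>Decode from the right. A catch in front of the decoded rest opens a new throw of length
  1; any other position must lengthen the first throw of the rest by one.\<close>

lemma expand_surj:
  assumes "w \<noteq> []" "successively step w" "snd (last w) = 1" "\<forall>p\<in>set w. snd p \<ge> 1"
  shows "\<exists>xs. xs \<noteq> [] \<and> positive xs \<and> w = expand xs"
  using assms
proof (induction w)
  case (Cons p w)
  obtain i j where p: "p = (i, j)" by fastforce
  show ?case
  proof (cases "w = []")
    case True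
    then show ?thesis
      using Cons.prems p by (intro exI[of _ "[(i, 1)]"]) simp
  next
    case False
    then obtain xs where xs: "xs \<noteq> []" "positive xs" "w = expand xs"
      using Cons by (auto simp: successively_Cons)
    then obtain i' m xs' where xs': "xs = (i', m) # xs'"
      by (metis neq_Nil_conv surj_pair)
    show ?thesis
    proof (cases "j = 1")
      case True
      then show ?thesis
        using xs p by (intro exI[of _ "(i, 1) # xs"]) simp
    next
      case j: False
      have "m \<ge> 1" using xs xs' by simp
      then have "hd w = (i', m)"
        using xs xs' by simp
      moreover have "step p (hd w)"
        using Cons.prems False by (auto simp: successively_Cons)
      ultimately have "i' = i" "j = Suc m"
        using j Cons.prems p by (auto simp: step_def)
      then show ?thesis
        using xs xs' p by (intro exI[of _ "(i, j) # xs'"]) simp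
    qed
  qed
qed simp

text \<open>The condition on the last throw is the choice of rotation in
  \<open>standard_words\<close>, read on throws.\<close>

definition throw_lists :: "nat \<Rightarrow> nat \<Rightarrow> (nat \<times> nat) list set" where
  "throw_lists n k = {xs. xs \<noteq> [] \<and> positive xs \<and> distinct (map fst xs) \<and>
     fst ` set xs \<subseteq> {1..k} \<and> sum_list (map snd xs) = n \<and>
     fst (last xs) = Min (fst ` set xs)}"

lemma expand_standard_iff:
  assumes "xs \<noteq> []" "positive xs"
  shows "expand xs \<in> standard_words n k \<longleftrightarrow> xs \<in> throw_lists n k"
proof -
  have "set (expand xs) \<subseteq> positions k \<longleftrightarrow> fst ` set xs \<subseteq> {1..k}"
    using assms by (force simp: set_expand positions_def)
  moreover have "fst (last xs) = Min (fst ` set xs) \<longleftrightarrow> (\<forall>i\<in>fst ` set xs. fst (last xs) \<le> i)"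
    using assms by (metis (no_types, lifting) List.finite_set Min_eqI Min_le finite_imageI imageI last_in_set)
  \<comment> \<open>The expansion ends at a catch, so the wrap-around arc holds
    automatically.\<close>
  moreover have "step (last (expand xs)) q" for q
    using assms by (simp add: last_expand step_def)
  ultimately show ?thesis
    using assms
    by (auto simp: standard_words_def cyclic_words_def throw_lists_def ball_arc_list_iff
        successively_expand last_expand expand_Nil_iff length_expand distinct_expand_iff
        catch_in_expand_iff[of xs, unfolded One_nat_def])
qed

lemma standard_words_eq: "standard_words n k = expand ` throw_lists n k"
proof (intro equalityI subsetI)
  fix w assume w: "w \<in> standard_words n k"
  then have "w \<noteq> []" "successively step w" "snd (last w) = 1" "\<forall>p\<in>set w. snd p \<ge> 1"
    by (auto simp: standard_words_def cyclic_words_def ball_arc_list_iff positions_def)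
  from expand_surj[OF this] w show "w \<in> expand ` throw_lists n k"
    by (auto simp: expand_standard_iff)
next
  fix w assume "w \<in> expand ` throw_lists n k"
  then show "w \<in> standard_words n k"
    by (auto simp: expand_standard_iff) (auto simp: throw_lists_def expand_standard_iff)
qed

section \<open>Counting throw lists\<close>

definition compositions :: "nat \<Rightarrow> nat \<Rightarrow> nat list set" where
  "compositions h n = {c. length c = h \<and> (\<forall>m\<in>set c. m \<ge> 1) \<and> sum_list c = n}"

lemma sum_list_map_Suc: "sum_list (map Suc c) = sum_list c + length c"
  by (induction c) auto

text \<open>Lowering each part by 1 leaves lists of \<open>h\<close> naturals with sum
  \<open>n - h\<close>, counted by stars and bars. For \<open>h > n\<close> both sides are
  0.\<close>

lemma card_compositions:
  assumes "h \<ge> 1" "n \<ge> 1"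
  shows "card (compositions h n) = (n - 1) choose (h - 1)"
proof (cases "h \<le> n")
  case True
  have "compositions h n = map Suc ` {c. length c = h \<and> sum_list c = n - h}"
  proof (intro equalityI subsetI)
    fix c assume c: "c \<in> compositions h n"
    then have eq: "map Suc (map (\<lambda>m. m - 1) c) = c"
      by (auto simp: compositions_def intro!: map_idI)
    have "sum_list (map (\<lambda>m. m - 1) c) + h = n"
      using sum_list_map_Suc[of "map (\<lambda>m. m - 1) c"] c unfolding eq
      by (simp add: compositions_def)
    with eq c show "c \<in> map Suc ` {c. length c = h \<and> sum_list c = n - h}"
      by (intro image_eqI[of _ _ "map (\<lambda>m. m - 1) c"]) (auto simp: compositions_def)
  qed (use True in \<open>auto simp: compositions_def sum_list_map_Suc\<close>)
  then have "card (compositions h n) = card {c :: nat list. length c = h \<and> sum_list c = n - h}"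
    by (simp add: card_image inj_on_def)
  also have "\<dots> = (n - h + h - 1) choose (n - h)"
    by (rule card_length_sum_list)
  also have "\<dots> = (n - 1) choose (h - 1)"
    using True assms binomial_symmetric[of "h - 1" "n - 1"] by simp
  finally show ?thesis .
next
  case False
  have "length c \<le> sum_list c" if "\<forall>m\<in>set c. m \<ge> 1" for c :: "nat list"
    using that by (induction c) auto
  with False have "compositions h n = {}"
    by (auto simp: compositions_def)
  with False assms show ?thesis by simp
qed

lemma finite_compositions: "finite (compositions h n)"
proof (rule finite_subset)
  show "compositions h n \<subseteq> {c. set c \<subseteq> {..n} \<and> length c = h}"
    by (auto simp: compositions_def member_le_sum_list)
qed (rule finite_lists_length_eq, simp)

section \<open>Throw lists split into hands, arrangement and lengths\<close>

text \<open>The arrangement omits \<open>Min H\<close>, whose place at the end is forced; this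
  produces the factor \<open>fact (h - 1)\<close>.\<close>

definition throw_data :: "nat \<Rightarrow> nat \<Rightarrow> (nat set \<times> nat list \<times> nat list) set" where
  "throw_data n k = (SIGMA H:Pow {1..k} - {{}}.
     permutations_of_set (H - {Min H}) \<times> compositions (card H) n)"

lemma throw_dataD:
  assumes "(H, ys, c) \<in> throw_data n k"
  shows "H = set (ys @ [Min H])" "length c = length (ys @ [Min H])" "distinct (ys @ [Min H])"
    "H \<subseteq> {1..k}" "\<forall>m\<in>set c. m \<ge> 1" "sum_list c = n"
proof -
  have H: "finite H" "H \<noteq> {}" and ys: "set ys = H - {Min H}" "distinct ys"
    and c: "length c = card H"
    using assms by (auto simp: throw_data_def permutations_of_set_def compositions_def
        intro: finite_subset)
  show eq: "H = set (ys @ [Min H])" using ys(1) Min_in[OF H] by (simp add: insert_absorb)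
  show dist: "distinct (ys @ [Min H])" using ys by simp
  show "length c = length (ys @ [Min H])" using c eq distinct_card[OF dist] by metis
qed (use assms in \<open>auto simp: throw_data_def compositions_def\<close>)

lemma bij_betw_throw_data:
  "bij_betw (\<lambda>(H, ys, c). zip (ys @ [Min H]) c) (throw_data n k) (throw_lists n k)"
proof -
  have "inj_on (\<lambda>(H, ys, c). zip (ys @ [Min H]) c) (throw_data n k)"
  proof (rule inj_onI)
    fix d d' assume dd': "d \<in> throw_data n k" "d' \<in> throw_data n k"
      and zips: "(case d of (H, ys, c) \<Rightarrow> zip (ys @ [Min H]) c)
        = (case d' of (H, ys, c) \<Rightarrow> zip (ys @ [Min H]) c)"
    obtain H ys c where d_eq: "d = (H, ys, c)" by (cases d)
    obtain H' ys' c' where d'_eq: "d' = (H', ys', c')" by (cases d')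
    have d: "(H, ys, c) \<in> throw_data n k" "(H', ys', c') \<in> throw_data n k"
      and eq: "zip (ys @ [Min H]) c = zip (ys' @ [Min H']) c'"
      using dd' zips by (simp_all add: d_eq d'_eq)
    \<comment> \<open>Since the zipped lists have equal lengths, both projections recover them in
      full; \<open>H\<close> is then the set of the first list.\<close>
    have "ys @ [Min H] = ys' @ [Min H']" "c = c'"
      using arg_cong[OF eq, of "map fst"] arg_cong[OF eq, of "map snd"]
        throw_dataD(2)[OF d(1)] throw_dataD(2)[OF d(2)]
      by (simp_all only: map_fst_zip map_snd_zip)
    moreover from this have "H = H'"
      using throw_dataD(1)[OF d(1)] throw_dataD(1)[OF d(2)] by metis
    ultimately show "d = d'" by (simp add: d_eq d'_eq)
  qed
  moreover have "(\<lambda>(H, ys, c). zip (ys @ [Min H]) c) ` throw_data n k = throw_lists n k"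
  proof (intro equalityI subsetI)
    fix xs assume "xs \<in> (\<lambda>(H, ys, c). zip (ys @ [Min H]) c) ` throw_data n k"
    then obtain H ys c where d: "(H, ys, c) \<in> throw_data n k"
      and xs: "xs = zip (ys @ [Min H]) c" by auto
    note D = throw_dataD[OF d]
    have fst: "map fst xs = ys @ [Min H]" and snd: "map snd xs = c"
      using D(2) xs by simp_all
    have "fst ` set xs = H"
      using fst D(1) by (metis list.set_map)
    moreover have "positive xs"
      using snd D(5) by (metis imageI list.set_map)
    moreover have "xs \<noteq> []"
      using fst by auto
    moreover from this have "fst (last xs) = Min H"
      using fst by (metis last_map last_snoc)
    ultimately show "xs \<in> throw_lists n k"
      using fst snd D(3,4,6) by (simp add: throw_lists_def)
  next
    fix xs assume xs: "xs \<in> throw_lists n k"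
    \<comment> \<open>Only the last hand is dropped from \<open>ys\<close>; it is
      \<open>Min H\<close> by the definition of \<open>throw_lists\<close>, so appending
      \<open>Min H\<close> restores the hands in order.\<close>
    define H ys where "H = fst ` set xs" and "ys = butlast (map fst xs)"
    have ne: "xs \<noteq> []" and dist: "distinct (map fst xs)" and last: "fst (last xs) = Min H"
      using xs by (auto simp: throw_lists_def H_def)
    have fst: "map fst xs = ys @ [Min H]"
      using ne last append_butlast_last_id[of "map fst xs"] by (simp add: ys_def last_map)
    have "H = set (ys @ [Min H])"
      using fst by (metis H_def list.set_map)
    then have "insert (Min H) (set ys) = H"
      by simp
    then have "set ys = H - {Min H}" "distinct ys"
      using dist unfolding fst by auto
    moreover have "length xs = card H"
      using distinct_card[OF dist] by (simp add: H_def)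
    ultimately have "(H, ys, map snd xs) \<in> throw_data n k"
      using xs by (auto simp: throw_data_def permutations_of_set_def compositions_def
          throw_lists_def H_def)
    moreover have "xs = zip (ys @ [Min H]) (map snd xs)"
      by (metis fst zip_map_fst_snd)
    ultimately show "xs \<in> (\<lambda>(H, ys, c). zip (ys @ [Min H]) c) ` throw_data n k"
      by force
  qed
  ultimately show ?thesis by (simp add: bij_betw_def)
qed

text \<open>Group the subsets by size; excluding the empty set makes the sum start at 1.\<close>

lemma sum_nonempty_subsets_by_card:
  fixes f :: "nat \<Rightarrow> nat"
  assumes "finite A"
  shows "(\<Sum>H\<in>Pow A - {{}}. f (card H)) = (\<Sum>h=1..card A. (card A choose h) * f h)"
proof -
  have "(\<Sum>H\<in>Pow A - {{}}. f (card H))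
      = (\<Sum>h=1..card A. \<Sum>H\<in>{H \<in> Pow A - {{}}. card H = h}. f (card H))"
    using assms by (intro sum.group[symmetric])
      (auto simp: card_mono Suc_le_eq card_gt_0_iff dest: finite_subset)
  also have "\<dots> = (\<Sum>h=1..card A. (card A choose h) * f h)"
  proof (rule sum.cong)
    fix h assume "h \<in> {1..card A}"
    then have "{H \<in> Pow A - {{}}. card H = h} = {H. H \<subseteq> A \<and> card H = h}" by auto
    then have "card {H \<in> Pow A - {{}}. card H = h} = card A choose h"
      using n_subsets[OF assms] by simp
    then show "(\<Sum>H\<in>{H \<in> Pow A - {{}}. card H = h}. f (card H)) = (card A choose h) * f h"
      by simp
  qed simp
  finally show ?thesis .
qed

theorem theorem5p1:
  fixes n k :: nat
  assumes "n \<ge> 1" and "k \<ge> 1"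
  shows "num_prime_patterns 1 n k
           = (\<Sum>h=1..k. (k choose h) * ((n - 1) choose (h - 1)) * fact (h - 1))"
proof -
  have "num_prime_patterns 1 n k = card (expand ` throw_lists n k)"
    unfolding num_prime_patterns_1 standard_words_eq ..
  also have "\<dots> = card (throw_lists n k)"
    by (intro card_image inj_on_subset[OF inj_on_expand]) (auto simp: throw_lists_def)
  also have "\<dots> = card (throw_data n k)"
    using bij_betw_same_card[OF bij_betw_throw_data] by simp
  also have "\<dots> = (\<Sum>H\<in>Pow {1..k} - {{}}.
      card (permutations_of_set (H - {Min H}) \<times> compositions (card H) n))"
    unfolding throw_data_def
    by (intro card_SigmaI) (auto simp: finite_compositions)
  also have "\<dots> = (\<Sum>H\<in>Pow {1..k} - {{}}. ((n - 1) choose (card H - 1)) * fact (card H - 1))"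
  proof (rule sum.cong)
    fix H assume "H \<in> Pow {1..k} - {{}}"
    then have H: "finite H" "H \<noteq> {}"
      by (auto intro: finite_subset)
    \<comment> \<open>The bound meets the hypothesis of \<open>card_compositions\<close>; the second
      fact turns the number of arrangements into \<open>fact (card H - 1)\<close>.\<close>
    then have "card H \<ge> 1" "card (H - {Min H}) = card H - 1"
      by (simp_all add: Suc_le_eq card_gt_0_iff)
    with H assms show "card (permutations_of_set (H - {Min H}) \<times> compositions (card H) n)
        = ((n - 1) choose (card H - 1)) * fact (card H - 1)"
      by (simp add: card_cartesian_product card_compositions mult.commute)
  qed simp
  also have "\<dots> = (\<Sum>h=1..k. (k choose h) * (((n - 1) choose (h - 1)) * fact (h - 1)))"
    using sum_nonempty_subsets_by_card[of "{1..k}" "\<lambda>h. ((n - 1) choose (h - 1)) * fact (h - 1)"]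
    by simp
  finally show ?thesis by (simp add: mult.assoc)
qed

end
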